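(* There exists a real bivariate sequence $\beta^{(8)}=\{\beta_{ij}\}_{i,j\ge0,\,i+j\le 8}$ whose moment matrix $M_4=M_4(\beta^{(8)})$ is recursively determinate and satisfies condition (G), and which admits a positive semidefinite, recursively generated extension $M_5$ that also satisfies condition (G), but such that $M_5$ admits no positive semidefinite, recursively generated extension $M_6$, and $\beta^{(8)}$ has no representing measure.
   Context: $\mathcal P_k$ is the space of real polynomials in $x,y$ of total degree at most $k$; for $f\in\mathcal P_k$, $\hat f$ is its coefficient vector with respect to the monomials in degree-lexicographic order. For a real sequence $\beta=\{\beta_{ij}\}_{i,j\ge0,\,i+j\le 2k}$, the moment matrix $M_k=M_k(\beta)$ has rows and columns indexed by the monomials of degree at most $k$ (denoted $1,X,Y,\ldots,X^k,\ldots,Y^k$), and the entry in row $X^iY^j$, column $X^sY^t$ is $\beta_{i+s,j+t}$. For $f=\sum a_{ij}x^iy^j\in\mathcal P_k$, $f(X,Y):=\sum a_{ij}X^iY^j=M_k\hat f$. $M_k$ is recursively generated if $f,g,fg\in\mathcal P_k$ and $f(X,Y)=0$ imply $(fg)(X,Y)=0$. An extension $M_{k+1}$ of $M_k$ is the moment matrix of a real sequence of degree $2k+2$ extending $\beta$. $M_k$ is recursively determinate if there are column relations $X^n=p(X,Y)$ with $1\le n\le k$, $p\in\mathcal P_{n-1}$, and $Y^m=q(X,Y)$ with $1\le m\le k$, $q\in\mathcal P_m$, $q$ having no $y^m$ term (or similar relations with the roles of $p$ and $q$ reversed). Condition (G) for $M_k$: $M_k$ is positive semidefinite and recursively generated and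 there are integers $1\le n,m\le k$, $p\in\mathcal P_{n-1}$, and $q\in\mathcal P_m$ all of whose terms $x^uy^v$ satisfy $v<m$, such that all column dependence relations of $M_k$ are generated by $X^n=p(X,Y)$ and $Y^m=q(X,Y)$ via recursiveness and linearity; that is, $\ker M_k$ is exactly the span of the vectors $\widehat{x^iy^j(x^n-p)}$ ($i,j\ge0$, $i+j+n\le k$) and $\widehat{x^iy^j(y^m-q)}$ ($i,j\ge0$, $i+j+m\le k$). A representing measure for $\beta^{(8)}$ is a positive Borel measure $\mu$ on $\mathbb R^2$ with $\beta_{ij}=\int x^iy^j\,d\mu$ for all $i,j\ge0$, $i+j\le 8$. *)

theory Defs
  imports "HOL-Analysis.Analysis" "HOL-Analysis.Finite_Function_Topology"
begin

text \<open>
  The monomial \<open>x\<^sup>i y\<^sup>j\<close> is the pair \<open>(i, j)\<close> and a polynomial is its finitely supported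
  coefficient function. Multiplication is the library's convolution product and
  the vector space structure is the pointwise one, so a polynomial supported on \<open>monomials k\<close>
  is also its own coefficient vector, with entries indexed by those monomials; the order in which
  the monomials are listed plays no role.
\<close>

type_synonym bipoly = "(nat \<times> nat) \<Rightarrow>\<^sub>0 real"

definition monomials :: "nat \<Rightarrow> (nat \<times> nat) set" where
  "monomials k = {(i, j). i + j \<le> k}"

definition monom_xy :: "nat \<Rightarrow> nat \<Rightarrow> bipoly" where
  "monom_xy i j = Poly_Mapping.single (i, j) 1"

definition polys :: "nat \<Rightarrow> bipoly set" where
  "polys k = {f. Poly_Mapping.keys f \<subseteq> monomials k}"

text \<open>
  A sequence of degree \<open>2 * k\<close> is a function of two indices of which only the values with
  \<open>i + j \<le> 2 * k\<close> are used; the size \<open>k\<close> of the moment matrix enters through the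
  index set \<open>monomials k\<close>.
\<close>

type_synonym biseq = "nat \<Rightarrow> nat \<Rightarrow> real"

definition moment_matrix :: "biseq \<Rightarrow> nat \<times> nat \<Rightarrow> nat \<times> nat \<Rightarrow> real" where
  "moment_matrix \<beta> r c = \<beta> (fst r + fst c) (snd r + snd c)"

text \<open>\<open>column k \<beta> f r\<close> is the entry in row \<open>r\<close> of \<open>f(X,Y)\<close>, the product of
  the moment matrix with the coefficient vector of \<open>f\<close>.\<close>

definition column :: "nat \<Rightarrow> biseq \<Rightarrow> bipoly \<Rightarrow> nat \<times> nat \<Rightarrow> real" where
  "column k \<beta> f r = (\<Sum>c\<in>monomials k. moment_matrix \<beta> r c * Poly_Mapping.lookup f c)"

definition column_relation :: "nat \<Rightarrow> biseq \<Rightarrow> bipoly \<Rightarrow> bipoly \<Rightarrow> bool" where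
  "column_relation k \<beta> f g \<longleftrightarrow> (\<forall>r\<in>monomials k. column k \<beta> f r = column k \<beta> g r)"

definition kernel :: "nat \<Rightarrow> biseq \<Rightarrow> bipoly set" where
  "kernel k \<beta> = {f \<in> polys k. \<forall>r\<in>monomials k. column k \<beta> f r = 0}"

text \<open>Moment matrices are symmetric by construction.\<close>

definition positive_semidefinite :: "nat \<Rightarrow> biseq \<Rightarrow> bool" where
  "positive_semidefinite k \<beta> \<longleftrightarrow>
     (\<forall>v :: nat \<times> nat \<Rightarrow> real.
        0 \<le> (\<Sum>r\<in>monomials k. \<Sum>c\<in>monomials k. v r * moment_matrix \<beta> r c * v c))"

definition recursively_generated :: "nat \<Rightarrow> biseq \<Rightarrow> bool" where
  "recursively_generated k \<beta> \<longleftrightarrow>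
     (\<forall>f g. f \<in> polys k \<longrightarrow> g \<in> polys k \<longrightarrow> f * g \<in> polys k \<longrightarrow>
        column_relation k \<beta> f 0 \<longrightarrow> column_relation k \<beta> (f * g) 0)"

definition recursively_determinate :: "nat \<Rightarrow> biseq \<Rightarrow> bool" where
  "recursively_determinate k \<beta> \<longleftrightarrow>
     (\<exists>n m p q. 1 \<le> n \<and> n \<le> k \<and> 1 \<le> m \<and> m \<le> k \<and>
        (p \<in> polys (n - 1) \<and> q \<in> polys m \<and> Poly_Mapping.lookup q (0, m) = 0 \<or>
         p \<in> polys n \<and> Poly_Mapping.lookup p (n, 0) = 0 \<and> q \<in> polys (m - 1)) \<and>
        column_relation k \<beta> (monom_xy n 0) p \<and> column_relation k \<beta> (monom_xy 0 m) q)"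

definition condition_G :: "nat \<Rightarrow> biseq \<Rightarrow> bool" where
  "condition_G k \<beta> \<longleftrightarrow>
     positive_semidefinite k \<beta> \<and> recursively_generated k \<beta> \<and>
     (\<exists>n m p q. 1 \<le> n \<and> n \<le> k \<and> 1 \<le> m \<and> m \<le> k \<and>
        p \<in> polys (n - 1) \<and> q \<in> polys m \<and> (\<forall>(u, v)\<in>Poly_Mapping.keys q. v < m) \<and>
        kernel k \<beta> =
          span ({monom_xy i j * (monom_xy n 0 - p) |i j. i + j + n \<le> k} \<union>
                {monom_xy i j * (monom_xy 0 m - q) |i j. i + j + m \<le> k}))"

definition extends :: "nat \<Rightarrow> biseq \<Rightarrow> biseq \<Rightarrow> bool" where
  "extends k \<beta> \<gamma> \<longleftrightarrow> (\<forall>i j. i + j \<le> 2 * k \<longrightarrow> \<gamma> i j = \<beta> i j)"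

definition representing_measure :: "nat \<Rightarrow> biseq \<Rightarrow> (real \<times> real) measure \<Rightarrow> bool" where
  "representing_measure d \<beta> \<mu> \<longleftrightarrow>
     sets \<mu> = sets borel \<and>
     (\<forall>i j. i + j \<le> d \<longrightarrow>
        integrable \<mu> (\<lambda>(x, y). x ^ i * y ^ j) \<and>
        \<beta> i j = (\<integral>(x, y). x ^ i * y ^ j \<partial>\<mu>))"

end

theory Submission
  imports Defs
begin

text \<open>Let \<open>L\<close> be the combination of the evaluations at the 16 points of the grid
  \<open>{-2, -1, 1, 2}\<^sup>2\<close> with weight \<open>-1\<close> at \<open>(1, 1)\<close> and weight 10 elsewhere. On polynomials of
  degree at most 5 the 16 evaluations satisfy one linear dependency, with all coefficients
  nonzero, so the value at \<open>(1, 1)\<close> is controlled by the other values and the quadratic form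
  \<open>f \<mapsto> L(f\<^sup>2)\<close> is positive definite modulo the polynomials vanishing on the grid; hence \<open>M\<^sub>4\<close> and
  \<open>M\<^sub>5\<close> are positive with kernel generated by \<open>x\<^sup>4 - (5x\<^sup>2 - 4)\<close> and \<open>y\<^sup>4 - (5y\<^sup>2 - 4)\<close>. In degree 6
  the polynomial \<open>N = (x + 1)(x\<^sup>2 - 4)(y + 1)(y\<^sup>2 - 4)\<close> vanishes at every grid point except
  \<open>(1, 1)\<close>, where it is 36. The column relations force \<open>L(N\<^sup>2) = 36 L(N) < 0\<close> in any recursively
  generated \<open>M\<^sub>6\<close>, while a representing measure would live on the grid, where \<open>N\<close> is nonnegative.\<close>

section \<open>The Riesz functional\<close>

definition riesz :: "biseq \<Rightarrow> bipoly \<Rightarrow> real" where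
  "riesz \<beta> f = (\<Sum>c\<in>Poly_Mapping.keys f. Poly_Mapping.lookup f c * \<beta> (fst c) (snd c))"

text \<open>Evaluation at a point is the Riesz functional of the unit mass there, so linearity is
  inherited from \<open>riesz\<close>.\<close>

definition peval :: "real \<times> real \<Rightarrow> bipoly \<Rightarrow> real" where
  "peval z = riesz (\<lambda>i j. fst z ^ i * snd z ^ j)"

lemma finite_monomials [simp]: "finite (monomials k)"
proof -
  have "monomials k \<subseteq> {..k} \<times> {..k}"
    by (auto simp: monomials_def)
  then show ?thesis
    by (rule finite_subset) simp
qed

lemma riesz_superset:
  assumes "finite S" "Poly_Mapping.keys f \<subseteq> S"
  shows "riesz \<beta> f = (\<Sum>c\<in>S. Poly_Mapping.lookup f c * \<beta> (fst c) (snd c))"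
  unfolding riesz_def
  by (rule sum.mono_neutral_left) (use assms in \<open>auto simp: in_keys_iff\<close>)

lemma lookup_scaleR [simp]:
  "Poly_Mapping.lookup (a *\<^sub>R f) c = a * Poly_Mapping.lookup (f :: bipoly) c"
proof -
  have "finite {i. a *\<^sub>R Poly_Mapping.lookup f i \<noteq> 0}"
    by (rule finite_subset[OF _ finite_lookup[of f]]) auto
  then show ?thesis
    by (simp add: scaleR_poly_mapping_def)
qed

text \<open>Turns scalars into constant polynomials, so that ring normalisation can handle
  identities that mix scaling and products.\<close>

lemma scaleR_eq_times: "a *\<^sub>R f = Poly_Mapping.single 0 a * (f :: bipoly)"
  by (rule poly_mapping_eqI)
    (simp add: Poly_Mapping.map.rep_eq when_def flip: mult_map_scale_conv_mult)

lemma scaleR_times_bipoly: "(a *\<^sub>R f) * g = a *\<^sub>R (f * (g :: bipoly))"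
  "f * (a *\<^sub>R g) = a *\<^sub>R (f * g)"
  by (simp_all add: scaleR_eq_times mult_ac)

lemma linear_riesz: "linear (riesz \<beta>)"
proof (rule linearI)
  fix f g :: bipoly
  let ?S = "Poly_Mapping.keys f \<union> Poly_Mapping.keys g"
  have "riesz \<beta> (f + g) = (\<Sum>c\<in>?S. Poly_Mapping.lookup (f + g) c * \<beta> (fst c) (snd c))"
    by (rule riesz_superset) (use keys_add[of f g] in auto)
  also have "\<dots> = (\<Sum>c\<in>?S. Poly_Mapping.lookup f c * \<beta> (fst c) (snd c))
      + (\<Sum>c\<in>?S. Poly_Mapping.lookup g c * \<beta> (fst c) (snd c))"
    by (simp add: lookup_add distrib_right sum.distrib)
  also have "\<dots> = riesz \<beta> f + riesz \<beta> g"
    by (simp flip: riesz_superset)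
  finally show "riesz \<beta> (f + g) = riesz \<beta> f + riesz \<beta> g" .
next
  fix a :: real and f :: bipoly
  have "riesz \<beta> (a *\<^sub>R f) =
      (\<Sum>c\<in>Poly_Mapping.keys f. Poly_Mapping.lookup (a *\<^sub>R f) c * \<beta> (fst c) (snd c))"
    by (rule riesz_superset) (auto simp: in_keys_iff)
  then show "riesz \<beta> (a *\<^sub>R f) = a *\<^sub>R riesz \<beta> f"
    by (simp add: riesz_def sum_distrib_left mult.assoc)
qed

lemmas riesz_add = linear_add[OF linear_riesz]
  and riesz_diff = linear_diff[OF linear_riesz]
  and riesz_sum = linear_sum[OF linear_riesz]

lemma riesz_scaleR: "riesz \<beta> (a *\<^sub>R f) = a * riesz \<beta> f"
  by (simp add: linear_scale[OF linear_riesz])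

lemma riesz_single: "riesz \<beta> (Poly_Mapping.single c a) = a * \<beta> (fst c) (snd c)"
  by (simp add: riesz_def)

lemma bipoly_eq_sum_single:
  assumes "finite S" "Poly_Mapping.keys f \<subseteq> S"
  shows "f = (\<Sum>c\<in>S. Poly_Mapping.single c (Poly_Mapping.lookup (f :: bipoly) c))"
proof (rule poly_mapping_eqI)
  fix k
  have "(\<Sum>c\<in>S. Poly_Mapping.lookup f c when c = k)
      = (\<Sum>c\<in>S. if c = k then Poly_Mapping.lookup f k else 0)"
    by (rule sum.cong) (auto simp: when_def)
  also have "\<dots> = Poly_Mapping.lookup f k"
    using assms by (auto simp: in_keys_iff)
  finally show "Poly_Mapping.lookup f k
      = Poly_Mapping.lookup (\<Sum>c\<in>S. Poly_Mapping.single c (Poly_Mapping.lookup f c)) k"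
    by (simp add: lookup_sum lookup_single)
qed

text \<open>The moment matrix is the Gram matrix of the monomials. Leaving \<open>S\<close> and
  \<open>T\<close> free lets the same formula cover quadratic forms (all monomials), columns (a
  singleton) and products of evaluations (the supports).\<close>

lemma riesz_times:
  assumes "finite S" "Poly_Mapping.keys f \<subseteq> S" "finite T" "Poly_Mapping.keys g \<subseteq> T"
  shows "riesz \<beta> (f * g) = (\<Sum>r\<in>S. \<Sum>c\<in>T.
    Poly_Mapping.lookup f r * moment_matrix \<beta> r c * Poly_Mapping.lookup g c)"
proof -
  have "f * g = (\<Sum>r\<in>S. \<Sum>c\<in>T. Poly_Mapping.single (r + c)
      (Poly_Mapping.lookup f r * Poly_Mapping.lookup g c))"
    by (subst bipoly_eq_sum_single[OF assms(1,2)], subst bipoly_eq_sum_single[OF assms(3,4)])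
      (simp add: sum_product mult_single)
  then show ?thesis
    by (simp add: riesz_sum riesz_single moment_matrix_def mult_ac)
qed

lemma peval_times: "peval z (f * g) = peval z f * peval z g"
  unfolding peval_def
  by (subst riesz_times[of "Poly_Mapping.keys f" _ "Poly_Mapping.keys g"])
    (auto simp: riesz_def moment_matrix_def power_add sum_product mult_ac)

lemma linear_peval: "linear (peval z)"
  unfolding peval_def by (rule linear_riesz)

lemma peval_one: "peval z 1 = 1"
  unfolding peval_def by (simp add: riesz_single flip: single_one)

lemma peval_numeral: "peval z (numeral n) = numeral n"
  unfolding peval_def by (simp add: riesz_single flip: single_numeral)

lemma peval_monom: "peval z (monom_xy i j) = fst z ^ i * snd z ^ j"
  by (simp add: peval_def monom_xy_def riesz_single)

lemmas peval_simps = peval_times peval_one peval_numeral peval_monom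
  linear_add[OF linear_peval] linear_diff[OF linear_peval]
  linear_scale[OF linear_peval]

lemma monom_xy_mult: "monom_xy i j * monom_xy s t = monom_xy (i + s) (j + t)"
  by (simp add: monom_xy_def mult_single)

lemma monom_xy_0: "monom_xy 0 0 = 1"
  by (simp add: monom_xy_def flip: zero_prod_def)

lemma single_eq_scaleR_monom: "Poly_Mapping.single (i, j) a = a *\<^sub>R monom_xy i j"
  by (rule poly_mapping_eqI) (simp add: monom_xy_def lookup_single when_def)

section \<open>Polynomials of bounded degree\<close>

lemma polys_iff: "f \<in> polys k \<longleftrightarrow> (\<forall>c. c \<notin> monomials k \<longrightarrow> Poly_Mapping.lookup f c = 0)"
  by (auto simp: polys_def in_keys_iff)

lemma subspace_polys: "subspace (polys k)"
  by (rule subspaceI) (simp_all add: polys_iff lookup_add)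

lemmas polys_add = subspace_add[OF subspace_polys]
  and polys_diff = subspace_diff[OF subspace_polys]
  and polys_scale = subspace_scale[OF subspace_polys]
  and polys_sum = subspace_sum[OF subspace_polys]

lemma polys_mono: "f \<in> polys k \<Longrightarrow> k \<le> l \<Longrightarrow> f \<in> polys l"
  by (force simp: polys_def monomials_def)

lemma monom_xy_in_polys: "i + j \<le> k \<Longrightarrow> monom_xy i j \<in> polys k"
  by (auto simp: polys_def monom_xy_def monomials_def)

lemma polys_one: "1 \<in> polys k"
  using monom_xy_in_polys[of 0 0] by (simp add: monom_xy_0)

lemma polys_numeral: "numeral n \<in> polys k"
  unfolding single_numeral[symmetric]
  by (auto simp: polys_def monomials_def zero_prod_def)

lemma polys_times: "f \<in> polys k \<Longrightarrow> g \<in> polys l \<Longrightarrow> f * g \<in> polys (k + l)"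
  using keys_mult[of f g] by (fastforce simp: polys_def monomials_def)

lemma polys_numeral_times: "f \<in> polys k \<Longrightarrow> numeral n * f \<in> polys k"
  using polys_times[OF polys_numeral, of f k n 0] by simp

lemma single_in_polys: "c \<in> monomials k \<Longrightarrow> Poly_Mapping.single c a \<in> polys k"
  by (auto simp: polys_def)

lemma polys_eq_sum_single:
  "f \<in> polys k \<Longrightarrow> f = (\<Sum>c\<in>monomials k. Poly_Mapping.single c (Poly_Mapping.lookup f c))"
  by (rule bipoly_eq_sum_single) (auto simp: polys_def)

section \<open>Columns, kernel and positivity in terms of the Riesz functional\<close>

lemma column_eq_riesz:
  assumes "f \<in> polys k"
  shows "column k \<beta> f (i, j) = riesz \<beta> (f * monom_xy i j)"
proof -
  have "riesz \<beta> (f * monom_xy i j) = (\<Sum>r\<in>monomials k. \<Sum>c\<in>{(i, j)}.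
      Poly_Mapping.lookup f r * moment_matrix \<beta> r c * Poly_Mapping.lookup (monom_xy i j) c)"
    by (rule riesz_times) (use assms in \<open>auto simp: polys_def monom_xy_def\<close>)
  then show ?thesis
    by (simp add: column_def monom_xy_def moment_matrix_def add.commute mult.commute)
qed

text \<open>The entries of \<open>f(X,Y)\<close> are the values of the functional at
  \<open>f\<close> times a monomial, and the monomials span \<open>polys k\<close>. Kernel
  membership thus becomes orthogonality to all of \<open>polys k\<close>.\<close>

lemma column_vanishes_iff:
  assumes "f \<in> polys k"
  shows "(\<forall>r\<in>monomials k. column k \<beta> f r = 0) \<longleftrightarrow> (\<forall>g\<in>polys k. riesz \<beta> (f * g) = 0)"
proof (intro iffI ballI)
  fix g assume *: "\<forall>r\<in>monomials k. column k \<beta> f r = 0" and g: "g \<in> polys k"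
  have "riesz \<beta> (f * Poly_Mapping.single r a) = 0" if "r \<in> monomials k" for r a
  proof -
    obtain i j where r: "r = (i, j)" by fastforce
    have "f * Poly_Mapping.single r a = a *\<^sub>R (f * monom_xy i j)"
      unfolding r single_eq_scaleR_monom scaleR_eq_times by (simp add: mult_ac)
    moreover have "riesz \<beta> (f * monom_xy i j) = 0"
      using * that r by (metis column_eq_riesz[OF assms])
    ultimately show ?thesis
      by (simp add: riesz_scaleR)
  qed
  then show "riesz \<beta> (f * g) = 0"
    by (subst polys_eq_sum_single[OF g]) (simp add: sum_distrib_left riesz_sum)
next
  fix r assume "\<forall>g\<in>polys k. riesz \<beta> (f * g) = 0" "r \<in> monomials k"
  then show "column k \<beta> f r = 0"
    by (cases r) (simp add: column_eq_riesz[OF assms] monom_xy_in_polys monomials_def)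
qed

lemma column_relation_0_iff:
  assumes "f \<in> polys k"
  shows "column_relation k \<beta> f 0 \<longleftrightarrow> (\<forall>g\<in>polys k. riesz \<beta> (f * g) = 0)"
  using column_vanishes_iff[OF assms] by (simp add: column_relation_def column_def)

lemma column_relation_diff:
  "column_relation k \<beta> f g \<longleftrightarrow> column_relation k \<beta> (f - g) 0"
  by (simp add: column_relation_def column_def lookup_minus right_diff_distrib sum_subtractf)

lemma kernel_eq: "kernel k \<beta> = {f \<in> polys k. \<forall>g\<in>polys k. riesz \<beta> (f * g) = 0}"
  using column_vanishes_iff by (auto simp: kernel_def)

lemma positive_semidefinite_iff:
  "positive_semidefinite k \<beta> \<longleftrightarrow> (\<forall>f\<in>polys k. 0 \<le> riesz \<beta> (f * f))"
proof safe
  fix f assume "positive_semidefinite k \<beta>" "f \<in> polys k"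
  then show "0 \<le> riesz \<beta> (f * f)"
    by (subst riesz_times[of "monomials k" _ "monomials k"])
      (auto simp: positive_semidefinite_def polys_def)
next
  assume *: "\<forall>f\<in>polys k. 0 \<le> riesz \<beta> (f * f)"
  show "positive_semidefinite k \<beta>"
    unfolding positive_semidefinite_def
  proof
    fix v :: "nat \<times> nat \<Rightarrow> real"
    \<comment> \<open>Only the values of \<open>v\<close> on \<open>monomials k\<close> enter the
      form, so truncating \<open>v\<close> to a polynomial loses nothing.\<close>
    define f where "f = (\<Sum>c\<in>monomials k. Poly_Mapping.single c (v c))"
    have f: "f \<in> polys k"
      unfolding f_def by (intro polys_sum single_in_polys)
    have v: "Poly_Mapping.lookup f c = v c" if "c \<in> monomials k" for c
    proof -
      have "Poly_Mapping.lookup f c = (\<Sum>d\<in>monomials k. if d = c then v c else 0)"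
        unfolding f_def lookup_sum by (rule sum.cong) (auto simp: lookup_single when_def)
      with that show ?thesis by simp
    qed
    have "riesz \<beta> (f * f) = (\<Sum>r\<in>monomials k. \<Sum>c\<in>monomials k.
        Poly_Mapping.lookup f r * moment_matrix \<beta> r c * Poly_Mapping.lookup f c)"
      by (rule riesz_times) (use f in \<open>auto simp: polys_def\<close>)
    also have "\<dots> = (\<Sum>r\<in>monomials k. \<Sum>c\<in>monomials k. v r * moment_matrix \<beta> r c * v c)"
      by (simp add: v)
    finally show "0 \<le> (\<Sum>r\<in>monomials k. \<Sum>c\<in>monomials k. v r * moment_matrix \<beta> r c * v c)"
      using * f by auto
  qed
qed

text \<open>When the square of \<open>f\<close> has value 0, the value of the square of
  \<open>g + t f\<close> is affine in \<open>t\<close>; being nonnegative for all \<open>t\<close>,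
  it has slope 0.\<close>

lemma psd_isotropic_orthogonal:
  assumes psd: "positive_semidefinite k \<beta>" and f: "f \<in> polys k" and g: "g \<in> polys k"
    and 0: "riesz \<beta> (f * f) = 0"
  shows "riesz \<beta> (f * g) = 0"
proof (rule ccontr)
  let ?b = "riesz \<beta> (f * g)" and ?c = "riesz \<beta> (g * g)"
  assume b: "?b \<noteq> 0"
  have "0 \<le> ?c + (t * ?b + t * ?b) + t * (t * 0)" for t
  proof -
    have "g + t *\<^sub>R f \<in> polys k"
      by (intro polys_add polys_scale f g)
    then have "0 \<le> riesz \<beta> ((g + t *\<^sub>R f) * (g + t *\<^sub>R f))"
      using psd by (simp add: positive_semidefinite_iff)
    also have "(g + t *\<^sub>R f) * (g + t *\<^sub>R f)
        = g * g + (t *\<^sub>R (f * g) + t *\<^sub>R (f * g)) + t *\<^sub>R t *\<^sub>R (f * f)"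
      by (simp only: distrib_left distrib_right scaleR_times_bipoly scaleR_add_right
          mult.commute[of g f] add_ac)
    finally show ?thesis
      by (simp only: riesz_add riesz_scaleR 0)
  qed
  \<comment> \<open>At this \<open>t\<close> the affine function takes the value
    \<open>?c - (?c + 1) = -1\<close>.\<close>
  from this[of "- (?c + 1) / (2 * ?b)"] b show False
    by (simp add: field_simps)
qed

lemma representing_measure_riesz:
  assumes "representing_measure d \<beta> \<mu>" "f \<in> polys d"
  shows "integrable \<mu> (\<lambda>z. peval z f)" "(\<integral>z. peval z f \<partial>\<mu>) = riesz \<beta> f"
proof -
  have m: "integrable \<mu> (\<lambda>z. fst z ^ fst c * snd z ^ snd c)"
    "(\<integral>z. fst z ^ fst c * snd z ^ snd c \<partial>\<mu>) = \<beta> (fst c) (snd c)" if "c \<in> Poly_Mapping.keys f" for c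
    using assms that
    by (auto simp: representing_measure_def polys_def monomials_def case_prod_unfold)
  then show "integrable \<mu> (\<lambda>z. peval z f)"
    unfolding peval_def riesz_def by auto
  show "(\<integral>z. peval z f \<partial>\<mu>) = riesz \<beta> f"
    unfolding peval_def riesz_def using m by (subst Bochner_Integration.integral_sum) auto
qed

section \<open>A functional on the four by four grid\<close>

definition nodes :: "real set" where
  "nodes = {-2, -1, 1, 2}"

text \<open>By the bound in \<open>grid_Cauchy_Schwarz\<close>, any weight above 84/16 = 5.25 in
  place of 10 makes the form definite modulo polynomials vanishing on the grid.\<close>

definition weight :: "real \<times> real \<Rightarrow> real" where
  "weight z = (if z = (1, 1) then -1 else 10)"

definition grid_seq :: biseq where
  "grid_seq i j = (\<Sum>z\<in>nodes \<times> nodes. weight z * (fst z ^ i * snd z ^ j))"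

definition x_rel :: bipoly where
  "x_rel = monom_xy 4 0 - (5 * monom_xy 2 0 - 4)"

definition y_rel :: bipoly where
  "y_rel = monom_xy 0 4 - (5 * monom_xy 0 2 - 4)"

definition relation_gens :: "nat \<Rightarrow> bipoly set" where
  "relation_gens k = {monom_xy i j * x_rel |i j. i + j + 4 \<le> k} \<union>
    {monom_xy i j * y_rel |i j. i + j + 4 \<le> k}"

lemma finite_nodes [simp]: "finite nodes"
  by (simp add: nodes_def)

lemma nodes_iff: "x \<in> nodes \<longleftrightarrow> x ^ 4 - (5 * x\<^sup>2 - 4) = 0"
proof -
  have "x ^ 4 - (5 * x\<^sup>2 - 4) = (x + 2) * (x + 1) * (x - 1) * (x - 2)"
    by (simp add: algebra_simps power2_eq_square power4_eq_xxxx)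
  then show ?thesis
    by (auto simp: nodes_def)
qed

lemma peval_x_rel: "peval z x_rel = 0 \<longleftrightarrow> fst z \<in> nodes"
  by (simp add: x_rel_def peval_simps nodes_iff)

lemma peval_y_rel: "peval z y_rel = 0 \<longleftrightarrow> snd z \<in> nodes"
  by (simp add: y_rel_def peval_simps nodes_iff)

section \<open>Grid evaluations: their linear dependency and positivity up to degree 5\<close>

lemma riesz_point_masses:
  "riesz (\<lambda>i j. \<Sum>z\<in>S. w z * (fst z ^ i * snd z ^ j)) f = (\<Sum>z\<in>S. w z * peval z f)"
  unfolding riesz_def peval_def sum_distrib_left
  by (subst sum.swap) (simp add: mult_ac)

lemma riesz_grid_seq: "riesz grid_seq f = (\<Sum>z\<in>nodes \<times> nodes. weight z * peval z f)"
  by (simp add: grid_seq_def[abs_def] riesz_point_masses)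

text \<open>The derivative of the node polynomial \<open>x^4 - 5x^2 + 4\<close> is
  \<open>2 * (2x^3 - 5x)\<close>, so these are Lagrange leading-coefficient weights, which
  annihilate degrees below 3. The factor 6 makes them the integers -1, 2, -2, 1.\<close>

lemma weighted_power_sum_nodes:
  assumes "i \<le> 2"
  shows "(\<Sum>x\<in>nodes. 6 / (2 * x ^ 3 - 5 * x) * x ^ i) = 0"
proof -
  from assms consider "i = 0" | "i = 1" | "i = 2" by linarith
  then show ?thesis
    by cases (simp_all add: nodes_def)
qed

text \<open>Up to scaling, the coefficients \<open>6 / (2x\<^sup>3 - 5x)\<close> are those of the third divided
  difference at the nodes. One of the two exponents of a monomial of degree at most 5 is less than 3.\<close>

lemma grid_dependency:
  assumes "f \<in> polys 5"
  shows "(\<Sum>z\<in>nodes \<times> nodes.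
    6 / (2 * fst z ^ 3 - 5 * fst z) * (6 / (2 * snd z ^ 3 - 5 * snd z)) * peval z f) = 0"
proof -
  have "(\<Sum>z\<in>nodes \<times> nodes. 6 / (2 * fst z ^ 3 - 5 * fst z) * (6 / (2 * snd z ^ 3 - 5 * snd z)) *
      (fst z ^ fst c * snd z ^ snd c)) = 0" if "c \<in> Poly_Mapping.keys f" for c
  proof -
    obtain i j where c: "c = (i, j)" by fastforce
    have "i + j \<le> 5"
      using assms that by (auto simp: polys_def monomials_def c)
    then have "i \<le> 2 \<or> j \<le> 2" by linarith
    then have "(\<Sum>x\<in>nodes. 6 / (2 * x ^ 3 - 5 * x) * x ^ i) *
        (\<Sum>y\<in>nodes. 6 / (2 * y ^ 3 - 5 * y) * y ^ j) = 0"
      using weighted_power_sum_nodes by auto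
    then show ?thesis
      by (simp add: c sum_product sum.cartesian_product case_prod_unfold mult_ac)
  qed
  then show ?thesis
    by (subst riesz_point_masses[symmetric]) (simp add: riesz_def)
qed

text \<open>Solve the dependency for the value at (1, 1), whose coefficient is (-2)(-2) = 4, and
  apply Cauchy-Schwarz to the other 15 terms.\<close>

lemma grid_Cauchy_Schwarz:
  assumes "f \<in> polys 5"
  shows "16 * (peval (1, 1) f)\<^sup>2 \<le> 84 * (\<Sum>z\<in>nodes \<times> nodes - {(1, 1)}. (peval z f)\<^sup>2)"
proof -
  define d :: "real \<Rightarrow> real" where "d x = 6 / (2 * x ^ 3 - 5 * x)" for x
  define c where "c z = d (fst z) * d (snd z)" for z
  let ?S = "nodes \<times> nodes - {(1, 1)}"
  have c11: "c (1, 1) = 4"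
    by (simp add: c_def d_def)
  have "(\<Sum>z\<in>nodes \<times> nodes. (c z)\<^sup>2) = (\<Sum>x\<in>nodes. (d x)\<^sup>2) * (\<Sum>y\<in>nodes. (d y)\<^sup>2)"
    by (simp add: c_def sum_product sum.cartesian_product case_prod_unfold power_mult_distrib)
  also have "(\<Sum>x\<in>nodes. (d x)\<^sup>2) = 10"
    by (simp add: nodes_def d_def power2_eq_square)
  \<comment> \<open>The full sum of squares is 10 * 10; removing the term \<open>4^2\<close> at (1,
    1) leaves 84.\<close>
  finally have c2: "(\<Sum>z\<in>?S. (c z)\<^sup>2) = 84"
    by (subst sum_diff1) (auto simp: c11 nodes_def)
  have "(\<Sum>z\<in>nodes \<times> nodes. c z * peval z f) = 0"
    using grid_dependency[OF assms] by (simp only: c_def d_def)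
  then have "4 * peval (1, 1) f = - (\<Sum>z\<in>?S. c z * peval z f)"
    by (subst sum_diff1) (auto simp: c11 nodes_def)
  then have "(4 * peval (1, 1) f)\<^sup>2 = (\<Sum>z\<in>?S. c z * peval z f)\<^sup>2"
    by simp
  also have "\<dots> \<le> (\<Sum>z\<in>?S. (c z)\<^sup>2) * (\<Sum>z\<in>?S. (peval z f)\<^sup>2)"
    by (rule Cauchy_Schwarz_ineq_sum)
  finally show ?thesis
    by (simp add: c2 power_mult_distrib)
qed

lemma riesz_grid_square:
  "riesz grid_seq (f * f)
     = 10 * (\<Sum>z\<in>nodes \<times> nodes - {(1, 1)}. (peval z f)\<^sup>2) - (peval (1, 1) f)\<^sup>2"
proof -
  have "riesz grid_seq (f * f)
      = (\<Sum>z\<in>nodes \<times> nodes - {(1, 1)}. weight z * peval z (f * f)) - peval (1, 1) (f * f)"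
    unfolding riesz_grid_seq by (subst sum.remove[of _ "(1, 1)"]) (auto simp: nodes_def weight_def)
  also have "(\<Sum>z\<in>nodes \<times> nodes - {(1, 1)}. weight z * peval z (f * f))
      = (\<Sum>z\<in>nodes \<times> nodes - {(1, 1)}. 10 * (peval z f)\<^sup>2)"
    by (rule sum.cong) (auto simp: weight_def peval_simps power2_eq_square)
  finally show ?thesis
    by (simp add: sum_distrib_left peval_simps power2_eq_square)
qed

lemma riesz_grid_square_nonneg:
  assumes "f \<in> polys 5"
  shows "0 \<le> riesz grid_seq (f * f)"
  using grid_Cauchy_Schwarz[OF assms] zero_le_power2[of "peval (1, 1) f"]
  unfolding riesz_grid_square by linarith

text \<open>With S the sum of squares off (1, 1), the hypothesis gives
  \<open>10 S = f(1,1)^2\<close>, while Cauchy-Schwarz bounds the right side by 5.25 S. Hence S = 0,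
  and then \<open>f(1,1) = 0\<close>.\<close>

lemma riesz_grid_square_eq_0:
  assumes f: "f \<in> polys 5" and 0: "riesz grid_seq (f * f) = 0" and z: "z \<in> nodes \<times> nodes"
  shows "peval z f = 0"
proof -
  let ?S = "nodes \<times> nodes - {(1, 1)}"
  have "(\<Sum>z\<in>?S. (peval z f)\<^sup>2) \<ge> 0"
    by (simp add: sum_nonneg)
  then have *: "(\<Sum>z\<in>?S. (peval z f)\<^sup>2) = 0" "(peval (1, 1) f)\<^sup>2 = 0"
    using grid_Cauchy_Schwarz[OF f] 0 unfolding riesz_grid_square by linarith+
  then have "\<forall>z\<in>?S. (peval z f)\<^sup>2 = 0"
    by (subst (asm) sum_nonneg_eq_0_iff) auto
  with * z show ?thesis
    by (cases "z = (1, 1)") auto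
qed

lemma riesz_grid_vanishing:
  assumes "\<And>z. z \<in> nodes \<times> nodes \<Longrightarrow> peval z f = 0"
  shows "riesz grid_seq f = 0"
  unfolding riesz_grid_seq using assms by (intro sum.neutral) auto

lemma x_rel_in_polys: "x_rel \<in> polys 4"
  unfolding x_rel_def
  by (intro polys_diff polys_numeral_times monom_xy_in_polys polys_numeral) auto

lemma y_rel_in_polys: "y_rel \<in> polys 4"
  unfolding y_rel_def
  by (intro polys_diff polys_numeral_times monom_xy_in_polys polys_numeral) auto

section \<open>Polynomials vanishing on the grid\<close>

lemma cubic_vanishing_on_nodes:
  assumes "\<And>x. x \<in> nodes \<Longrightarrow> a 0 + a 1 * x + a 2 * x\<^sup>2 + a 3 * x ^ 3 = 0"
  shows "a 0 = 0" "a 1 = 0" "a 2 = 0" "a (3::nat) = (0::real)"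
  using assms[of "-2"] assms[of "-1"] assms[of 1] assms[of 2] by (simp_all add: nodes_def)

lemma sum_vanishing_on_nodes:
  assumes "\<And>x. x \<in> nodes \<Longrightarrow> (\<Sum>i<4. a i * x ^ i) = 0" and "i < 4"
  shows "a i = (0::real)"
proof -
  have "a 0 + a 1 * x + a 2 * x\<^sup>2 + a 3 * x ^ 3 = 0" if "x \<in> nodes" for x
    using assms(1)[OF that] by (simp add: numeral_eq_Suc)
  from cubic_vanishing_on_nodes[of a, OF this] \<open>i < 4\<close> show ?thesis
    by (auto simp: numeral_eq_Suc less_Suc_eq)
qed

text \<open>Uniqueness of tensor-product interpolation: a univariate cubic with four roots is zero.
  This is applied first in \<open>y\<close> with \<open>x\<close> fixed, then in \<open>x\<close> to
  each coefficient.\<close>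

lemma reduced_vanishing_on_grid:
  assumes "Poly_Mapping.keys r \<subseteq> {..<4} \<times> {..<4}"
    and van: "\<And>z. z \<in> nodes \<times> nodes \<Longrightarrow> peval z r = 0"
  shows "r = 0"
proof (rule poly_mapping_eqI)
  fix c
  have "Poly_Mapping.lookup r (i, j) = 0" if "i < 4" "j < 4" for i j
  proof -
    have "(\<Sum>j<4. (\<Sum>i<4. Poly_Mapping.lookup r (i, j) * x ^ i) * y ^ j) = 0"
      if "x \<in> nodes" "y \<in> nodes" for x y
    proof -
      have "peval (x, y) r = (\<Sum>c\<in>{..<4} \<times> {..<4}. Poly_Mapping.lookup r c * (x ^ fst c * y ^ snd c))"
        unfolding peval_def by (subst riesz_superset[OF _ assms(1)]) auto
      also have "\<dots> = (\<Sum>j<4. \<Sum>i<4. Poly_Mapping.lookup r (i, j) * (x ^ i * y ^ j))"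
        by (subst sum.swap) (simp add: sum.cartesian_product case_prod_unfold)
      also have "\<dots> = (\<Sum>j<4. (\<Sum>i<4. Poly_Mapping.lookup r (i, j) * x ^ i) * y ^ j)"
        by (simp add: sum_distrib_right mult.assoc)
      finally show ?thesis
        using van[of "(x, y)"] that by simp
    qed
    then have "(\<Sum>i<4. Poly_Mapping.lookup r (i, j) * x ^ i) = 0" if "x \<in> nodes" for x
      using that \<open>j < 4\<close>
      by (intro sum_vanishing_on_nodes[of "\<lambda>j. \<Sum>i<4. Poly_Mapping.lookup r (i, j) * x ^ i"])
    then show ?thesis
      using \<open>i < 4\<close> by (rule sum_vanishing_on_nodes[of "\<lambda>i. Poly_Mapping.lookup r (i, j)"])
  qed
  with assms(1) show "Poly_Mapping.lookup r c = Poly_Mapping.lookup 0 c"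
    by (cases "c \<in> Poly_Mapping.keys r") (auto simp: in_keys_iff)
qed

text \<open>Replacing \<open>x^4\<close> by \<open>5x^2 - 4\<close>, or likewise in
  \<open>y\<close>, lowers the total degree by at least 2, and the multiple of the relation used has
  degree at most \<open>k\<close>. This keeps the reduction inside the generators allowed by
  condition (G).\<close>

lemma monom_reduction:
  assumes "i + j \<le> k"
  shows "monom_xy i j \<in> span (relation_gens k \<union> {monom_xy s t |s t. s < 4 \<and> t < 4})"
    (is "_ \<in> span ?B")
  using assms
proof (induction "i + j" arbitrary: i j rule: less_induct)
  case less
  consider (x) "4 \<le> i" | (y) "4 \<le> j" | (low) "i < 4" "j < 4" by linarith
  then show ?case
  proof cases
    case x
    then obtain s where i: "i = s + 4" by (metis add.commute le_Suc_ex)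
    have "monom_xy i j = monom_xy s j * x_rel + (5 *\<^sub>R monom_xy (s + 2) j - 4 *\<^sub>R monom_xy s j)"
      by (simp add: i x_rel_def scaleR_eq_times algebra_simps monom_xy_mult
          mult.left_commute[of "monom_xy s j"])
    moreover have "monom_xy s j * x_rel \<in> span ?B"
    proof (rule span_base)
      have "s + j + 4 \<le> k"
        using less.prems i by simp
      then show "monom_xy s j * x_rel \<in> ?B"
        unfolding relation_gens_def by blast
    qed
    moreover have "monom_xy (s + 2) j \<in> span ?B" "monom_xy s j \<in> span ?B"
      using less.hyps less.prems i by simp_all
    ultimately show ?thesis
      by (simp only: span_add span_diff span_scale)
  next
    case y
    then obtain t where j: "j = t + 4" by (metis add.commute le_Suc_ex)
    have "monom_xy i j = monom_xy i t * y_rel + (5 *\<^sub>R monom_xy i (t + 2) - 4 *\<^sub>R monom_xy i t)"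
      by (simp add: j y_rel_def scaleR_eq_times algebra_simps monom_xy_mult
          mult.left_commute[of "monom_xy i t"])
    moreover have "monom_xy i t * y_rel \<in> span ?B"
    proof (rule span_base)
      have "i + t + 4 \<le> k"
        using less.prems j by simp
      then show "monom_xy i t * y_rel \<in> ?B"
        unfolding relation_gens_def by blast
    qed
    moreover have "monom_xy i (t + 2) \<in> span ?B" "monom_xy i t \<in> span ?B"
      using less.hyps less.prems j by simp_all
    ultimately show ?thesis
      by (simp only: span_add span_diff span_scale)
  next
    case low
    then show ?thesis
      by (intro span_base) auto
  qed
qed

lemma relation_gens_vanish:
  assumes "f \<in> span (relation_gens k)" "z \<in> nodes \<times> nodes"
  shows "peval z f = 0"
proof -
  have "subspace {f. peval z f = 0}"
    by (rule subspaceI) (simp_all add: peval_simps linear_0[OF linear_peval])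
  moreover have "relation_gens k \<subseteq> {f. peval z f = 0}"
    using assms(2) peval_x_rel[of z] peval_y_rel[of z]
    by (auto simp: relation_gens_def peval_times)
  ultimately show ?thesis
    using span_minimal assms(1) by blast
qed

lemma relation_gens_subset_polys: "span (relation_gens k) \<subseteq> polys k"
proof (rule span_minimal[OF _ subspace_polys])
  have "monom_xy i j * x_rel \<in> polys k" "monom_xy i j * y_rel \<in> polys k" if "i + j + 4 \<le> k" for i j
    using polys_times[OF monom_xy_in_polys[of i j "i + j"] x_rel_in_polys]
      polys_times[OF monom_xy_in_polys[of i j "i + j"] y_rel_in_polys] that
    by (auto intro: polys_mono)
  then show "relation_gens k \<subseteq> polys k"
    by (auto simp: relation_gens_def)
qed

text \<open>Reduce \<open>f\<close> modulo the generators. The remainder has degree below 4 in each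
  variable and still vanishes on the grid, so it is zero.\<close>

lemma vanishing_on_grid_imp_span:
  assumes f: "f \<in> polys k" and van: "\<And>z. z \<in> nodes \<times> nodes \<Longrightarrow> peval z f = 0"
  shows "f \<in> span (relation_gens k)"
proof -
  let ?M = "{monom_xy s t |s t. s < 4 \<and> t < 4}"
  have "f \<in> span (relation_gens k \<union> ?M)"
    by (subst polys_eq_sum_single[OF f])
      (auto simp: monomials_def single_eq_scaleR_monom intro!: span_sum span_scale monom_reduction)
  then obtain g r where gr: "f = g + r" and g: "g \<in> span (relation_gens k)" and r: "r \<in> span ?M"
    by (auto simp: span_Un)
  have "subspace {r :: bipoly. Poly_Mapping.keys r \<subseteq> {..<4} \<times> {..<4}}"
  proof -
    have "{r :: bipoly. Poly_Mapping.keys r \<subseteq> {..<4} \<times> {..<4}}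
        = {r. \<forall>c. c \<notin> {..<4} \<times> {..<4} \<longrightarrow> Poly_Mapping.lookup r c = 0}"
      by (auto simp: in_keys_iff)
    then show ?thesis
      by (simp only:, intro subspaceI) (simp_all add: lookup_add)
  qed
  moreover have "?M \<subseteq> {r. Poly_Mapping.keys r \<subseteq> {..<4} \<times> {..<4}}"
    by (auto simp: monom_xy_def)
  ultimately have "Poly_Mapping.keys r \<subseteq> {..<4} \<times> {..<4}"
    using span_minimal r by blast
  moreover have "peval z r = 0" if "z \<in> nodes \<times> nodes" for z
    using van[OF that] relation_gens_vanish[OF g that] by (simp add: gr peval_simps)
  ultimately have "r = 0"
    by (rule reduced_vanishing_on_grid)
  with gr g show ?thesis by simp
qed

section \<open>Kernels of M_4 and M_5, and condition (G)\<close>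

lemma kernel_grid_seq_iff:
  assumes "k \<le> 5"
  shows "f \<in> kernel k grid_seq \<longleftrightarrow> f \<in> polys k \<and> (\<forall>z\<in>nodes \<times> nodes. peval z f = 0)"
proof
  assume f: "f \<in> kernel k grid_seq"
  \<comment> \<open>Testing \<open>f\<close> against itself gives an isotropic polynomial, to which
    definiteness on the grid applies.\<close>
  then have "f \<in> polys 5" "riesz grid_seq (f * f) = 0"
    using assms by (auto simp: kernel_eq intro: polys_mono)
  with f show "f \<in> polys k \<and> (\<forall>z\<in>nodes \<times> nodes. peval z f = 0)"
    using riesz_grid_square_eq_0 by (auto simp: kernel_eq)
next
  assume "f \<in> polys k \<and> (\<forall>z\<in>nodes \<times> nodes. peval z f = 0)"
  then show "f \<in> kernel k grid_seq"
    by (auto simp: kernel_eq peval_times intro!: riesz_grid_vanishing)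
qed

lemma kernel_grid_seq:
  assumes "k \<le> 5"
  shows "kernel k grid_seq = span (relation_gens k)"
proof (rule set_eqI)
  fix f
  show "f \<in> kernel k grid_seq \<longleftrightarrow> f \<in> span (relation_gens k)"
    unfolding kernel_grid_seq_iff[OF assms]
    using relation_gens_vanish vanishing_on_grid_imp_span relation_gens_subset_polys by blast
qed

lemma column_relation_0_iff_kernel:
  "f \<in> polys k \<Longrightarrow> column_relation k \<beta> f 0 \<longleftrightarrow> f \<in> kernel k \<beta>"
  by (simp add: column_relation_0_iff kernel_eq)

text \<open>The kernel consists of the polynomials of bounded degree vanishing on the grid, and
  vanishing survives multiplication.\<close>

lemma recursively_generated_grid_seq: "k \<le> 5 \<Longrightarrow> recursively_generated k grid_seq"
  by (simp add: recursively_generated_def column_relation_0_iff_kernel kernel_grid_seq_iff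
      peval_times)

lemma positive_semidefinite_grid_seq: "k \<le> 5 \<Longrightarrow> positive_semidefinite k grid_seq"
  by (auto simp: positive_semidefinite_iff intro: riesz_grid_square_nonneg polys_mono)

lemma keys_reduced_terms:
  "Poly_Mapping.keys (5 * monom_xy 2 0 - 4) \<subseteq> {(0, 0), (2, 0)}"
  "Poly_Mapping.keys (5 * monom_xy 0 2 - 4) \<subseteq> {(0, 0), (0, 2)}"
proof -
  have "5 * f = 5 *\<^sub>R f" for f :: bipoly
    by (simp add: scaleR_eq_times)
  then show "Poly_Mapping.keys (5 * monom_xy 2 0 - 4) \<subseteq> {(0, 0), (2, 0)}"
    "Poly_Mapping.keys (5 * monom_xy 0 2 - 4) \<subseteq> {(0, 0), (0, 2)}"
    by (auto simp: in_keys_iff lookup_minus lookup_single lookup_numeral monom_xy_def when_def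
        zero_prod_def split: if_splits)
qed

lemma condition_G_grid_seq:
  assumes "4 \<le> k" "k \<le> 5"
  shows "condition_G k grid_seq"
proof -
  let ?p = "5 * monom_xy 2 0 - 4" and ?q = "5 * monom_xy 0 2 - 4"
  have p: "?p \<in> polys (4 - 1)" and q: "?q \<in> polys 4" and "\<forall>(u, v)\<in>Poly_Mapping.keys ?q. v < 4"
    unfolding polys_def using keys_reduced_terms by (auto simp: monomials_def)
  moreover have "kernel k grid_seq =
      span ({monom_xy i j * (monom_xy 4 0 - ?p) |i j. i + j + 4 \<le> k} \<union>
            {monom_xy i j * (monom_xy 0 4 - ?q) |i j. i + j + 4 \<le> k})"
    using kernel_grid_seq assms by (simp add: relation_gens_def x_rel_def y_rel_def)
  ultimately have "1 \<le> (4::nat) \<and> 4 \<le> k \<and> 1 \<le> (4::nat) \<and> 4 \<le> k \<and> ?p \<in> polys (4 - 1) \<and>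
      ?q \<in> polys 4 \<and> (\<forall>(u, v)\<in>Poly_Mapping.keys ?q. v < 4) \<and> kernel k grid_seq =
      span ({monom_xy i j * (monom_xy 4 0 - ?p) |i j. i + j + 4 \<le> k} \<union>
            {monom_xy i j * (monom_xy 0 4 - ?q) |i j. i + j + 4 \<le> k})"
    using assms by simp
  then show ?thesis
    unfolding condition_G_def
    using positive_semidefinite_grid_seq recursively_generated_grid_seq assms by blast
qed

lemma recursively_determinate_grid_seq: "recursively_determinate 4 grid_seq"
proof -
  let ?p = "5 * monom_xy 2 0 - 4" and ?q = "5 * monom_xy 0 2 - 4"
  have "?p \<in> polys (4 - 1)" "?q \<in> polys 4"
    unfolding polys_def using keys_reduced_terms by (auto simp: monomials_def)
  moreover have "(0, 4) \<notin> Poly_Mapping.keys ?q"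
    using keys_reduced_terms(2) by auto
  then have "Poly_Mapping.lookup ?q (0, 4) = 0"
    by (simp only: in_keys_iff not_not)
  moreover have "column_relation 4 grid_seq (monom_xy 4 0) ?p"
    "column_relation 4 grid_seq (monom_xy 0 4) ?q"
    \<comment> \<open>Fixing the left side to be a monomial keeps this rewriting from applying again
      to its own result.\<close>
    unfolding column_relation_diff[of _ _ "monom_xy _ _"] x_rel_def[symmetric] y_rel_def[symmetric]
    using x_rel_in_polys y_rel_in_polys peval_x_rel peval_y_rel
    by (auto simp: column_relation_0_iff_kernel kernel_grid_seq_iff)
  ultimately show ?thesis
    unfolding recursively_determinate_def
    by (intro exI[of _ 4] exI[of _ ?p] exI[of _ ?q]) auto
qed

section \<open>The obstruction\<close>

text \<open>The factor of N in \<open>x\<close>: it is -6 at the node 1 and 0 at the other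
  nodes.\<close>

definition x_cubic :: bipoly where
  "x_cubic = (monom_xy 1 0 + 1) * (monom_xy 1 0 * monom_xy 1 0 - 4)"

definition y_cubic :: bipoly where
  "y_cubic = (monom_xy 0 1 + 1) * (monom_xy 0 1 * monom_xy 0 1 - 4)"

lemma cubics_in_polys: "x_cubic \<in> polys 3" "y_cubic \<in> polys 3"
proof -
  have "(m + 1) * (m * m - 4) \<in> polys 3" if m: "m \<in> polys 1" for m
  proof -
    have "(m + 1) * (m * m - 4) \<in> polys (1 + (1 + 1))"
      by (intro polys_times polys_add polys_diff polys_one polys_numeral m)
    then show ?thesis
      by (simp add: numeral_3_eq_3)
  qed
  then show "x_cubic \<in> polys 3" "y_cubic \<in> polys 3"
    by (simp_all add: x_cubic_def y_cubic_def monom_xy_in_polys)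
qed

lemma peval_cubics:
  "peval (x, y) x_cubic = (x + 1) * (x\<^sup>2 - 4)"
  "peval (x, y) y_cubic = (y + 1) * (y\<^sup>2 - 4)"
  by (simp_all add: x_cubic_def y_cubic_def peval_simps power2_eq_square)

text \<open>On the nodes \<open>x_cubic\<close> takes only the values 0 and -6, so its square agrees
  with \<open>-6 * x_cubic\<close> modulo \<open>x_rel\<close>; the cofactor
  \<open>x^2 + 2x - 2\<close> comes from polynomial division.\<close>

lemma x_cubic_square:
  "x_cubic * x_cubic =
    x_rel * (monom_xy 2 0 + 2 * monom_xy 1 0 - 2) - 6 * x_cubic"
proof -
  have "monom_xy 2 0 = monom_xy 1 0 * monom_xy 1 0"
    "monom_xy 4 0 = monom_xy 1 0 * monom_xy 1 0 * monom_xy 1 0 * monom_xy 1 0"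
    by (simp_all add: monom_xy_mult numeral_eq_Suc)
  then show ?thesis
    by (simp add: x_cubic_def x_rel_def algebra_simps)
qed

lemma riesz_grid_cubics:
  "riesz grid_seq (x_cubic * y_cubic) = -36"
  "riesz grid_seq (x_cubic * (y_cubic * y_cubic)) = 216"
  by (simp_all add: riesz_grid_seq peval_times nodes_def weight_def peval_cubics
      flip: sum.cartesian_product add: case_prod_unfold sum.cartesian_product)

section \<open>Absence of a representing measure\<close>

lemma grid_seq_no_representing_measure: "\<not> representing_measure 8 grid_seq \<mu>"
proof
  assume m: "representing_measure 8 grid_seq \<mu>"
  \<comment> \<open>A polynomial of degree at most 4 has its square within the prescribed moments,
    so vanishing on the grid forces it to vanish almost everywhere.\<close>
  have AE0: "AE z in \<mu>. peval z f = 0"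
    if f: "f \<in> polys 4" and "\<And>z. z \<in> nodes \<times> nodes \<Longrightarrow> peval z f = 0" for f
  proof -
    have ff: "f * f \<in> polys 8"
      using polys_times[OF f f] by simp
    have "(\<integral>z. (peval z f)\<^sup>2 \<partial>\<mu>) = 0"
      using representing_measure_riesz(2)[OF m ff] riesz_grid_vanishing[of "f * f"] that
      by (simp add: peval_times power2_eq_square)
    moreover have "integrable \<mu> (\<lambda>z. (peval z f)\<^sup>2)"
      using representing_measure_riesz(1)[OF m ff] by (simp add: peval_times power2_eq_square)
    ultimately show ?thesis
      by (subst (asm) integral_nonneg_eq_0_iff_AE) auto
  qed
  have "AE z in \<mu>. peval z x_rel = 0" "AE z in \<mu>. peval z y_rel = 0"
    by (rule AE0; use x_rel_in_polys y_rel_in_polys in \<open>auto simp: peval_x_rel peval_y_rel\<close>)+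
  \<comment> \<open>The measure is thus concentrated on the grid, where the product of the cubics is
    36 at (1, 1) and 0 elsewhere; yet its Riesz value is -36.\<close>
  then have "AE z in \<mu>. 0 \<le> peval z (x_cubic * y_cubic)"
  proof eventually_elim
    case (elim z)
    then have "fst z \<in> nodes" "snd z \<in> nodes"
      by (simp_all add: peval_x_rel peval_y_rel)
    then show ?case
      by (cases z) (auto simp: nodes_def peval_times peval_cubics)
  qed
  then have "0 \<le> (\<integral>z. peval z (x_cubic * y_cubic) \<partial>\<mu>)"
    by (rule integral_nonneg_AE)
  also have "\<dots> = riesz grid_seq (x_cubic * y_cubic)"
    by (rule representing_measure_riesz(2)[OF m])
      (use polys_times[OF cubics_in_polys] in \<open>auto intro: polys_mono\<close>)
  finally show False
    by (simp add: riesz_grid_cubics)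
qed

section \<open>Absence of an extension M_6\<close>

lemma extends_riesz:
  assumes "extends k \<beta> \<delta>" "f \<in> polys (2 * k)"
  shows "riesz \<delta> f = riesz \<beta> f"
  unfolding riesz_def
  using assms by (intro sum.cong) (auto simp: extends_def polys_def monomials_def)

lemma grid_seq_no_extension:
  assumes ext: "extends 5 grid_seq \<delta>" and psd: "positive_semidefinite 6 \<delta>"
    and rg: "recursively_generated 6 \<delta>"
  shows False
proof -
  let ?s = "monom_xy 2 0 + 2 * monom_xy 1 0 - 2"
  have s: "?s \<in> polys 2"
    by (intro polys_diff polys_add polys_numeral_times polys_numeral monom_xy_in_polys) simp_all
  have A6: "x_rel \<in> polys 6" and s6: "?s \<in> polys 6" and As: "x_rel * ?s \<in> polys 6"
    using polys_mono[OF x_rel_in_polys] polys_mono[OF s] polys_times[OF x_rel_in_polys s] by simp_all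
  \<comment> \<open>This square has degree 8, so its value is fixed by the degree-10 data;
    positivity of M_6 then puts \<open>x_rel\<close> in the kernel.\<close>
  have "x_rel * x_rel \<in> polys (2 * 5)"
    using polys_times[OF x_rel_in_polys x_rel_in_polys] by (rule polys_mono) simp
  then have "riesz \<delta> (x_rel * x_rel) = riesz grid_seq (x_rel * x_rel)"
    by (rule extends_riesz[OF ext])
  also have "\<dots> = 0"
    by (rule riesz_grid_vanishing) (auto simp: peval_times peval_x_rel)
  finally have "column_relation 6 \<delta> x_rel 0"
    using psd_isotropic_orthogonal[OF psd A6] by (simp add: column_relation_0_iff[OF A6])
  then have "column_relation 6 \<delta> (x_rel * ?s) 0"
    using rg A6 s6 As by (auto simp: recursively_generated_def)
  moreover have yy: "y_cubic * y_cubic \<in> polys 6"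
    using polys_times[OF cubics_in_polys(2,2)] by simp
  ultimately have 0: "riesz \<delta> (x_rel * ?s * (y_cubic * y_cubic)) = 0"
    using column_relation_0_iff[OF As] by blast
  \<comment> \<open>The square of N has degree 12, beyond the known moments. Reducing only the
    square in \<open>x\<close> leaves this product of degree 9, whose value is prescribed.\<close>
  have xyy: "x_cubic * (y_cubic * y_cubic) \<in> polys (2 * 5)"
    using polys_times[OF cubics_in_polys(1) yy] by (rule polys_mono) simp
  have xy: "x_cubic * y_cubic \<in> polys 6"
    using polys_times[OF cubics_in_polys] by simp
  have "(x_cubic * y_cubic) * (x_cubic * y_cubic)
      = (x_cubic * x_cubic) * (y_cubic * y_cubic)"
    by (simp add: mult_ac)
  also have "\<dots> = x_rel * ?s * (y_cubic * y_cubic) - 6 *\<^sub>R (x_cubic * (y_cubic * y_cubic))"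
    by (simp only: x_cubic_square left_diff_distrib scaleR_eq_times single_numeral mult.assoc)
  finally have "riesz \<delta> ((x_cubic * y_cubic) * (x_cubic * y_cubic))
      = - 6 * riesz \<delta> (x_cubic * (y_cubic * y_cubic))"
    by (simp only: riesz_diff riesz_scaleR 0)
  also have "riesz \<delta> (x_cubic * (y_cubic * y_cubic)) = 216"
    using extends_riesz[OF ext xyy] by (simp add: riesz_grid_cubics)
  \<comment> \<open>The square of N gets the value -6 * 216 < 0, against positivity.\<close>
  finally show False
    using psd xy by (force simp: positive_semidefinite_iff)
qed

theorem mainTheorem6:
  shows "\<exists>\<beta> :: nat \<Rightarrow> nat \<Rightarrow> real.
    recursively_determinate 4 \<beta> \<and> condition_G 4 \<beta> \<and>
    (\<exists>\<gamma>. extends 4 \<beta> \<gamma> \<and>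
       positive_semidefinite 5 \<gamma> \<and> recursively_generated 5 \<gamma> \<and> condition_G 5 \<gamma> \<and>
       \<not> (\<exists>\<delta>. extends 5 \<gamma> \<delta> \<and>
              positive_semidefinite 6 \<delta> \<and> recursively_generated 6 \<delta>)) \<and>
    \<not> (\<exists>\<mu>. representing_measure 8 \<beta> \<mu>)"
proof (intro exI conjI)
  \<comment> \<open>As \<open>grid_seq\<close> is defined for all indices, it supplies both the
    degree-8 data and their degree-10 extension.\<close>
  show "extends 4 grid_seq grid_seq"
    by (simp add: extends_def)
qed (use grid_seq_no_extension grid_seq_no_representing_measure in \<open>auto simp:
  recursively_determinate_grid_seq condition_G_grid_seq positive_semidefinite_grid_seq recursively_generated_grid_seq\<close>)

end
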